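(* Let $L$ be a linear operator on $\mathbb{R}^m$ satisfying $$\|e^{\tau L}u\|\le \|u\|\qquad\text{for all }u\in\mathbb{R}^m\text{ and all }\tau\ge 0,$$ and let $N:\mathbb{R}^m\to\mathbb{R}^m$ be a (possibly nonlinear) operator such that for some value $\Delta t_{FE}>0$ $$\|u+\Delta t\,N(u)\|\le\|u\|\qquad\text{for all }u\in\mathbb{R}^m\text{ and all }0\le\Delta t\le\Delta t_{FE}.$$ Let an explicit $s$-stage Runge--Kutta method be given by Shu--Osher coefficients $\alpha_{i,j},\beta_{i,j}$ ($1\le i\le s$, $0\le j\le i-1$) with $\alpha_{i,j}\ge0$, $\beta_{i,j}\ge0$, $\sum_{j=0}^{i-1}\alpha_{i,j}=1$ for each $i$, and $\alpha_{i,j}=0$ only if $\beta_{i,j}=0$; let $c_0,\dots,c_s$ be its abscissas and let $\mathcal{C}=\min_{i,j}\alpha_{i,j}/\beta_{i,j}$ be its SSP coefficient. Given $u^n\in\mathbb{R}^m$, let $u^{n+1}$ be obtained from the integrating factor Runge--Kutta method $$u^{(0)}=u^n,\qquad u^{(i)}=\sum_{j=0}^{i-1}e^{L(c_i-c_j)\Delta t}\left(\alpha_{i,j}u^{(j)}+\Delta t\,\beta_{i,j}N(u^{(j)})\right),\quad i=1,\dots,s,\qquad u^{n+1}=u^{(s)}.$$ If the abscissas are non-decreasing, $0=c_0\le c_1\le\cdots\le c_s$, then $$\|u^{n+1}\|\le\|u^n\|\qquad\text{for all }0\le\Delta t\le\mathcal{C}\,\Delta t_{FE}.$$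
   Context: The setting is a semi-discretized problem $u_t=Lu+N(u)$, i.e. a finite system of ODEs with unknown $u(t)\in\mathbb{R}^m$, where $L$ is a constant $m\times m$ matrix. The symbol $\|\cdot\|$ denotes a fixed convex functional $\mathbb{R}^m\to\mathbb{R}$ (for instance a norm or a semi-norm such as the total variation semi-norm); $e^{\tau L}$ is the matrix exponential. An explicit $s$-stage Runge--Kutta method for $u_t=F(u)$ in Shu--Osher form is $$u^{(0)}=u^n,\quad u^{(i)}=\sum_{j=0}^{i-1}\left(\alpha_{i,j}u^{(j)}+\Delta t\,\beta_{i,j}F(u^{(j)})\right)\ (i=1,\dots,s),\quad u^{n+1}=u^{(s)}.$$ The abscissa $c_i$ of stage $u^{(i)}$ is the number such that $u^{(i)}$ approximates the solution at time $t^n+c_i\Delta t$, that is, $c_0=0$ and $c_i=\sum_{j=0}^{i-1}(\alpha_{i,j}c_j+\beta_{i,j})$. In the minimum defining $\mathcal{C}$, a ratio $\alpha_{i,j}/\beta_{i,j}$ with $\beta_{i,j}=0$ is considered infinite (if $\mathcal C=\infty$, the step-size restriction is just $\Delta t\ge 0$). *)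

theory Defs
  imports "HOL-Analysis.Analysis"
begin

text \<open>The type of square matrices is not an instance of the class of normed algebras
  (its class multiplication is componentwise), so the library's \<open>exp\<close> does not apply to it.\<close>

definition matrix_power :: "real^'m^'m \<Rightarrow> nat \<Rightarrow> real^'m^'m" where
  "matrix_power A k = (((**) A) ^^ k) (mat 1)"

definition matrix_exp :: "real^'m^'m \<Rightarrow> real^'m^'m" where
  "matrix_exp A = (\<Sum>k. (1 / fact k) *\<^sub>R matrix_power A k)"

lemma matrix_power_entry_bound:
  fixes A :: "real^'m^'m"
  assumes "\<And>i j. \<bar>A $ i $ j\<bar> \<le> a"
  shows "\<bar>matrix_power A k $ i $ j\<bar> \<le> (real CARD('m) * a) ^ k"
proof (induction k arbitrary: i j)
  case 0
  then show ?case by (simp add: matrix_power_def mat_def)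
next
  case (Suc k)
  have "a \<ge> 0" using assms[of i j] by linarith
  have "matrix_power A (Suc k) $ i $ j = (\<Sum>l\<in>UNIV. A $ i $ l * matrix_power A k $ l $ j)"
    by (simp add: matrix_power_def matrix_matrix_mult_def)
  also have "\<bar>\<dots>\<bar> \<le> (\<Sum>l\<in>UNIV. \<bar>A $ i $ l * matrix_power A k $ l $ j\<bar>)"
    by (rule sum_abs)
  also have "\<dots> \<le> (\<Sum>l\<in>(UNIV :: 'm set). a * (real CARD('m) * a) ^ k)"
    using assms Suc \<open>a \<ge> 0\<close> by (intro sum_mono) (auto simp: abs_mult intro!: mult_mono)
  also have "\<dots> = (real CARD('m) * a) ^ Suc k" by simp
  finally show ?case .
qed

lemma summable_matrix_exp:
  fixes A :: "real^'m^'m"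
  shows "summable (\<lambda>k. (1 / fact k) *\<^sub>R matrix_power A k)"
proof -
  define n where "n = real CARD('m)"
  have entry: "\<bar>A $ i $ j\<bar> \<le> norm A" for i j
    by (rule order_trans[OF component_le_norm_cart Finite_Cartesian_Product.norm_nth_le])
  have nrm: "norm (matrix_power A k) \<le> n * (n * (n * norm A) ^ k)" for k
  proof -
    have "norm (matrix_power A k $ i) \<le> n * (n * norm A) ^ k" for i
    proof -
      have "norm (matrix_power A k $ i) \<le> (\<Sum>j\<in>UNIV. \<bar>matrix_power A k $ i $ j\<bar>)"
        by (rule norm_le_l1_cart)
      also have "\<dots> \<le> (\<Sum>j\<in>(UNIV :: 'm set). (n * norm A) ^ k)"
        unfolding n_def by (intro sum_mono matrix_power_entry_bound entry)
      finally show ?thesis by (simp add: n_def)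
    qed
    then have "(\<Sum>i\<in>UNIV. norm (matrix_power A k $ i)) \<le> (\<Sum>i\<in>(UNIV :: 'm set). n * (n * norm A) ^ k)"
      by (intro sum_mono)
    moreover have "norm (matrix_power A k) \<le> (\<Sum>i\<in>UNIV. norm (matrix_power A k $ i))"
      unfolding norm_vec_def by (rule L2_set_le_sum) simp
    ultimately show ?thesis by (simp add: n_def)
  qed
  have "summable (\<lambda>k. n * n * (inverse (fact k) * (n * norm A) ^ k))"
    by (intro summable_mult summable_exp)
  then show ?thesis
  proof (rule summable_comparison_test')
    fix k :: nat
    have "norm ((1 / fact k) *\<^sub>R matrix_power A k) = norm (matrix_power A k) / fact k"
      by simp
    also have "\<dots> \<le> n * (n * (n * norm A) ^ k) / fact k"
      by (intro divide_right_mono nrm) simp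
    finally show "norm ((1 / fact k) *\<^sub>R matrix_power A k)
        \<le> n * n * (inverse (fact k) * (n * norm A) ^ k)"
      by (simp add: field_simps)
  qed
qed

text \<open>An explicit \<open>s\<close>-stage method is given by its Shu--Osher coefficients
  \<open>\<alpha> i j\<close>, \<open>\<beta> i j\<close>; only the values with \<open>1 \<le> i \<le> s\<close>, \<open>j < i\<close> are relevant.\<close>

definition shu_osher_coeffs :: "nat \<Rightarrow> (nat \<Rightarrow> nat \<Rightarrow> real) \<Rightarrow> (nat \<Rightarrow> nat \<Rightarrow> real) \<Rightarrow> bool" where
  "shu_osher_coeffs s \<alpha> \<beta> \<longleftrightarrow>
     1 \<le> s \<and>
     (\<forall>i\<in>{1..s}. (\<Sum>j<i. \<alpha> i j) = 1 \<and>
        (\<forall>j<i. 0 \<le> \<alpha> i j \<and> 0 \<le> \<beta> i j \<and> (\<alpha> i j = 0 \<longrightarrow> \<beta> i j = 0)))"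

fun abscissa :: "(nat \<Rightarrow> nat \<Rightarrow> real) \<Rightarrow> (nat \<Rightarrow> nat \<Rightarrow> real) \<Rightarrow> nat \<Rightarrow> real" where
  "abscissa \<alpha> \<beta> i = (if i = 0 then 0 else \<Sum>j<i. \<alpha> i j * abscissa \<alpha> \<beta> j + \<beta> i j)"

text \<open>Ratios with zero denominator count as infinite, so the coefficient is an extended real;
  the index set is finite, and nonempty for \<open>s \<ge> 1\<close>.\<close>

definition ssp_coeff :: "nat \<Rightarrow> (nat \<Rightarrow> nat \<Rightarrow> real) \<Rightarrow> (nat \<Rightarrow> nat \<Rightarrow> real) \<Rightarrow> ereal" where
  "ssp_coeff s \<alpha> \<beta> =
     (MIN (i, j)\<in>(SIGMA i:{1..s}. {..<i}). if \<beta> i j = 0 then \<infinity> else ereal (\<alpha> i j / \<beta> i j))"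

fun if_stage :: "(nat \<Rightarrow> nat \<Rightarrow> real) \<Rightarrow> (nat \<Rightarrow> nat \<Rightarrow> real) \<Rightarrow> real^'m^'m \<Rightarrow>
    (real^'m \<Rightarrow> real^'m) \<Rightarrow> real \<Rightarrow> real^'m \<Rightarrow> nat \<Rightarrow> real^'m" where
  "if_stage \<alpha> \<beta> L N dt un i =
     (if i = 0 then un
      else \<Sum>j<i. matrix_exp (((abscissa \<alpha> \<beta> i - abscissa \<alpha> \<beta> j) * dt) *\<^sub>R L) *v
             (\<alpha> i j *\<^sub>R if_stage \<alpha> \<beta> L N dt un j
              + (dt * \<beta> i j) *\<^sub>R N (if_stage \<alpha> \<beta> L N dt un j)))"

definition if_rk_step :: "nat \<Rightarrow> (nat \<Rightarrow> nat \<Rightarrow> real) \<Rightarrow> (nat \<Rightarrow> nat \<Rightarrow> real) \<Rightarrow> real^'m^'m \<Rightarrow>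
    (real^'m \<Rightarrow> real^'m) \<Rightarrow> real \<Rightarrow> real^'m \<Rightarrow> real^'m" where
  "if_rk_step s \<alpha> \<beta> L N dt un = if_stage \<alpha> \<beta> L N dt un s"

declare abscissa.simps [simp del] if_stage.simps [simp del]

end

theory Submission
  imports Defs
begin

text \<open>Each stage is a convex combination of forward Euler steps of lengths
  \<open>dt * \<beta> i j / \<alpha> i j \<le> dt_FE\<close>, each followed by the flow of \<open>L\<close> over the
  nonnegative time \<open>(c\<^sub>i - c\<^sub>j) * dt\<close>; neither operation increases the functional, and convexity
  passes the bound from the terms to the stage.\<close>

lemma ssp_coeff_le:
  assumes "1 \<le> i" "i \<le> s" "j < i" "\<beta> i j \<noteq> 0"
  shows "ssp_coeff s \<alpha> \<beta> \<le> ereal (\<alpha> i j / \<beta> i j)"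
proof -
  let ?f = "\<lambda>(i, j). if \<beta> i j = 0 then \<infinity> else ereal (\<alpha> i j / \<beta> i j)"
  have "Min (?f ` (SIGMA i:{1..s}. {..<i})) \<le> ?f (i, j)"
    using assms by (intro Min_le imageI finite_imageI finite_SigmaI) auto
  then show ?thesis
    using assms by (simp add: ssp_coeff_def)
qed

text \<open>The restriction on \<open>dt\<close> involves a minimum over all pairs; comparing that
  minimum with the single ratio \<open>\<alpha> i j / \<beta> i j\<close> localizes it to one term
  of one stage.\<close>

lemma euler_step_le:
  assumes "shu_osher_coeffs s \<alpha> \<beta>" "1 \<le> i" "i \<le> s" "j < i"
    and "dt_FE > 0" "ereal dt \<le> ssp_coeff s \<alpha> \<beta> * ereal dt_FE"
  shows "dt * \<beta> i j / \<alpha> i j \<le> dt_FE"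
proof (cases "\<beta> i j = 0")
  case True
  then show ?thesis using assms by simp
next
  case False
  have "0 \<le> \<alpha> i j" "0 \<le> \<beta> i j" "\<alpha> i j = 0 \<longrightarrow> \<beta> i j = 0"
    using assms by (auto simp: shu_osher_coeffs_def)
  with False have pos: "0 < \<alpha> i j" "0 < \<beta> i j"
    by auto
  \<comment> \<open>Replacing the possibly infinite coefficient by a finite ratio lets the
    inequality return to the reals.\<close>
  have "ereal dt \<le> ereal (\<alpha> i j / \<beta> i j) * ereal dt_FE"
    using assms False by (intro order_trans[OF assms(6)] ereal_mult_right_mono ssp_coeff_le) auto
  then show ?thesis
    using pos by (simp add: field_simps)
qed

theorem theorem2:
  fixes \<phi> :: "real^'m \<Rightarrow> real"
    and L :: "real^'m^'m"
    and N :: "real^'m \<Rightarrow> real^'m"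
    and dt_FE :: real
    and s :: nat
    and \<alpha> \<beta> :: "nat \<Rightarrow> nat \<Rightarrow> real"
    and un :: "real^'m"
  assumes "convex_on UNIV \<phi>"
    and "\<forall>u. \<forall>\<tau>\<ge>0. \<phi> (matrix_exp (\<tau> *\<^sub>R L) *v u) \<le> \<phi> u"
    and "dt_FE > 0"
    and "\<forall>u. \<forall>dt. 0 \<le> dt \<and> dt \<le> dt_FE \<longrightarrow> \<phi> (u + dt *\<^sub>R N u) \<le> \<phi> u"
    and "shu_osher_coeffs s \<alpha> \<beta>"
    and "\<forall>i<s. abscissa \<alpha> \<beta> i \<le> abscissa \<alpha> \<beta> (Suc i)"
  shows "\<forall>dt. 0 \<le> dt \<and> ereal dt \<le> ssp_coeff s \<alpha> \<beta> * ereal dt_FE \<longrightarrow>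
           \<phi> (if_rk_step s \<alpha> \<beta> L N dt un) \<le> \<phi> un"
proof (intro allI impI, elim conjE)
  fix dt :: real
  assume dt: "0 \<le> dt" and cfl: "ereal dt \<le> ssp_coeff s \<alpha> \<beta> * ereal dt_FE"
  let ?c = "abscissa \<alpha> \<beta>"
  let ?u = "if_stage \<alpha> \<beta> L N dt un"
  \<comment> \<open>Makes every flow time \<open>(?c i - ?c j) * dt\<close> nonnegative.\<close>
  have mono: "?c j \<le> ?c i" if "j \<le> i" "i \<le> s" for i j
    using that(1,2)
  proof (induction i rule: dec_induct)
    case (step k)
    then show ?case using assms(6) by (force intro: order_trans)
  qed simp
  have "\<phi> (?u i) \<le> \<phi> un" if "i \<le> s" for i
    using that
  proof (induction i rule: less_induct)
    case (less i)
    show ?case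
    proof (cases "i = 0")
      case True
      then show ?thesis by (simp add: if_stage.simps)
    next
      case False
      then have i: "1 \<le> i" "i \<le> s"
        using less.prems by auto
      have coeffs: "(\<Sum>j<i. \<alpha> i j) = 1" "0 \<le> \<alpha> i j" "0 \<le> \<beta> i j" "\<alpha> i j = 0 \<longrightarrow> \<beta> i j = 0"
        if "j < i" for j
        using assms(5) i that by (auto simp: shu_osher_coeffs_def)
      \<comment> \<open>Factoring \<open>\<alpha> i j\<close> out of the term, by linearity of the
        flow, leaves a full Euler step from \<open>?u j\<close> and turns the
        \<open>\<alpha> i j\<close> into convex weights.\<close>
      define y where "y j = matrix_exp (((?c i - ?c j) * dt) *\<^sub>R L) *v
        (?u j + (dt * \<beta> i j / \<alpha> i j) *\<^sub>R N (?u j))" for j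
      have "?u i = (\<Sum>j<i. matrix_exp (((?c i - ?c j) * dt) *\<^sub>R L) *v
             (\<alpha> i j *\<^sub>R ?u j + (dt * \<beta> i j) *\<^sub>R N (?u j)))"
        using False by (subst if_stage.simps) simp
      also have "\<dots> = (\<Sum>j<i. \<alpha> i j *\<^sub>R y j)"
      proof (rule sum.cong[OF refl])
        fix j assume "j \<in> {..<i}"
        \<comment> \<open>also valid for \<open>\<alpha> i j = 0\<close>, as then \<open>\<beta> i j = 0\<close>\<close>
        then have "\<alpha> i j * (dt * \<beta> i j / \<alpha> i j) = dt * \<beta> i j"
          using coeffs by auto
        then show "matrix_exp (((?c i - ?c j) * dt) *\<^sub>R L) *v
             (\<alpha> i j *\<^sub>R ?u j + (dt * \<beta> i j) *\<^sub>R N (?u j)) = \<alpha> i j *\<^sub>R y j"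
          by (simp add: y_def scaleR_right_distrib flip: matrix_vector_mult_scaleR)
      qed
      finally have u: "?u i = (\<Sum>j<i. \<alpha> i j *\<^sub>R y j)" .
      have y: "\<phi> (y j) \<le> \<phi> un" if j: "j < i" for j
      proof -
        have "\<phi> (y j) \<le> \<phi> (?u j + (dt * \<beta> i j / \<alpha> i j) *\<^sub>R N (?u j))"
          unfolding y_def using assms(2) mono[of j i] dt i j by simp
        also have "\<dots> \<le> \<phi> (?u j)"
          using assms(4) euler_step_le[OF assms(5) i j assms(3) cfl] coeffs[OF j] dt by simp
        also have "\<dots> \<le> \<phi> un"
          using less.IH j i by simp
        finally show ?thesis .
      qed
      \<comment> \<open>Jensen's inequality; \<open>i \<noteq> 0\<close> makes the index set
        nonempty.\<close>
      have "\<phi> (?u i) \<le> (\<Sum>j<i. \<alpha> i j * \<phi> (y j))"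
        unfolding u using assms(1) coeffs False by (intro convex_on_sum) auto
      also have "\<dots> \<le> (\<Sum>j<i. \<alpha> i j * \<phi> un)"
        using y coeffs by (intro sum_mono mult_left_mono) auto
      also have "\<dots> = \<phi> un"
        \<comment> \<open>The row sum in \<open>coeffs\<close> carries the premise
          \<open>j < i\<close>; the instance \<open>j = 0\<close> satisfies it.\<close>
        using coeffs(1)[of 0] False by (simp flip: sum_distrib_right)
      finally show ?thesis .
    qed
  qed
  then show "\<phi> (if_rk_step s \<alpha> \<beta> L N dt un) \<le> \<phi> un"
    by (simp add: if_rk_step_def)
qed

end
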